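(* Let $D\ge 3$ be an integer and let $d$ be a positive integer. Consider the following semidefinite program in the real variables $x^t_{i,j}$, $(i,j,t)\in\mathcal I'$: maximize $\displaystyle\sum_{i=0}^{D}\binom{2D+1}{i}x^0_{i,0}$ subject to (1) $x^0_{0,0}=1$; (2) $0\le x^t_{i,j}\le x^0_{i,0}$ for all $(i,j,t)\in\mathcal I'$; (3) $x^t_{i,j}=x^{t'}_{i',j'}$ whenever $(i,j,t),(i',j',t')\in\mathcal I'$, $0\le i+j-2t\le D$, and $(i',j',i'+j'-2t')$ is a permutation of $(i,j,i+j-2t)$; (4) $x^t_{i,j}=x^{t'}_{i',j'}$ whenever $(i,j,t),(i',j',t')\in\mathcal I'$, $D+1\le i+j-2t\le 2D$, and $(i',j',2D+1-(i'+j'-2t'))$ is a permutation of $(i,j,2D+1-(i+j-2t))$; (5) $x^t_{i,j}=0$ whenever $\{i,j,i+j-2t,2D+1-(i+j-2t)\}\cap\{1,2,\dots,d-1\}\neq\emptyset$; (6) for each $r=0,1,\dots,D$ the two matrices $\Big(\sum_{t}\beta^r_{i,j,t}x^t_{i,j}\Big)_{i,j=r}^{D}$ and $\Big(\sum_{t}\beta^r_{i,j,t}(x^0_{\nu,0}-x^t_{i,j})\Big)_{i,j=r}^{D}$ are positive semidefinite, where each sum runs over all $t$ with $(i,j,t)\in\mathcal I'$ and $\nu=\min\{i+j-2t,\,2D+1-(i+j-2t)\}$. Then the optimal value of this semidefinite program is an upper bound on $A(\square_{2D+1},d)$.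
   Context: Let $S=\{1,\dots,2D+1\}$ and let $X$ be the set of unordered pairs $\{u,u'\}$ of subsets of $S$ with $u\cap u'=\emptyset$ and $u\cup u'=S$. The folded $(2D+1)$-cube $\square_{2D+1}$ is the graph with vertex set $X$ whose path-length distance is $\partial(x,y)=\min\{|x_1\triangle y_1|,|x_1\triangle y_2|\}$ for $x=\{x_1,x_2\}$, $y=\{y_1,y_2\}$; it is distance-regular with diameter $D$. For a graph $\Gamma$, $A(\Gamma,d)$ is the maximum size of a set $C$ of vertices with $\partial(x,y)\ge d$ for all distinct $x,y\in C$. Index set: $\mathcal I'=\{(i,j,t)\in\mathbb Z^3:0\le t\le i,j\le D,\ i+j-t\le 2D\}$. Binomial coefficients $\binom ab$ are $0$ unless $0\le b\le a$, and $\beta^r_{i,j,t}=\binom{2D+1-2r}{i-r}\sum_{l=0}^{D}(-1)^{r-l}\binom rl\binom{i-l}{t-l}\binom{2D+1+l-i-r}{j-t-r+l}$.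
   Formalization: The formal theorem assumes in addition d ≤ 2D+1; for d ≥ 2D+2, constraint (5) at (i,j,t)=(0,0,0) forces x^0_{0,0}=0, contradicting (1), so the program is infeasible and has no optimal value, while A=1. *)

theory Defs
  imports Complex_Main "HOL-Library.Multiset" "HOL-Library.Extended_Real"
begin

definition folded_verts :: "nat \<Rightarrow> nat set set set" where
  "folded_verts D = {{u, u'} |u u'. u \<inter> u' = {} \<and> u \<union> u' = {1..2 * D + 1}}"

text \<open>Complementing both arguments of a symmetric difference leaves it unchanged, so the
  minimum over all pairs of representatives is the minimum over the two pairs with a fixed
  first component; see \<open>folded_dist_eq\<close>.\<close>

definition folded_dist :: "nat set set \<Rightarrow> nat set set \<Rightarrow> nat" where
  "folded_dist x y = Min {card (sym_diff u v) |u v. u \<in> x \<and> v \<in> y}"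

lemma folded_dist_eq:
  assumes "x1 \<inter> x2 = {}" "x1 \<union> x2 = {1..2 * D + 1}"
    and "y1 \<inter> y2 = {}" "y1 \<union> y2 = {1..2 * D + 1}"
  shows "folded_dist {x1, x2} {y1, y2} = min (card (sym_diff x1 y1)) (card (sym_diff x1 y2))"
proof -
  have 1: "sym_diff x2 y2 = sym_diff x1 y1" and 2: "sym_diff x2 y1 = sym_diff x1 y2"
    using assms by blast+
  have "{card (sym_diff u v) |u v. u \<in> {x1, x2} \<and> v \<in> {y1, y2}}
      = {card (sym_diff x1 y1), card (sym_diff x1 y2), card (sym_diff x2 y1), card (sym_diff x2 y2)}"
    by blast
  also have "\<dots> = {card (sym_diff x1 y1), card (sym_diff x1 y2)}"
    unfolding 1 2 by blast
  finally show ?thesis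
    unfolding folded_dist_def by simp
qed

definition max_code_size :: "'v set \<Rightarrow> ('v \<Rightarrow> 'v \<Rightarrow> nat) \<Rightarrow> nat \<Rightarrow> nat" where
  "max_code_size V \<delta> d =
     Max {card C |C. C \<subseteq> V \<and> (\<forall>x\<in>C. \<forall>y\<in>C. x \<noteq> y \<longrightarrow> d \<le> \<delta> x y)}"

definition A_folded :: "nat \<Rightarrow> nat \<Rightarrow> nat" where
  "A_folded D d = max_code_size (folded_verts D) folded_dist d"

text \<open>On this set the natural-number differences \<open>i + j - t\<close>, \<open>i + j - 2 * t\<close> and
  \<open>2 * D + 1 - (i + j - 2 * t)\<close> used below agree with the integer ones.\<close>

definition idx :: "nat \<Rightarrow> (nat \<times> nat \<times> nat) set" where
  "idx D = {(i, j, t). t \<le> i \<and> t \<le> j \<and> i \<le> D \<and> j \<le> D \<and> i + j - t \<le> 2 * D}"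

definition ibinom :: "int \<Rightarrow> int \<Rightarrow> real" where
  "ibinom a b = (if 0 \<le> b \<and> b \<le> a then real (nat a choose nat b) else 0)"

definition beta_coeff :: "nat \<Rightarrow> nat \<Rightarrow> nat \<Rightarrow> nat \<Rightarrow> nat \<Rightarrow> real" where
  "beta_coeff D r i j t =
     ibinom (2 * int D + 1 - 2 * int r) (int i - int r) *
     (\<Sum>l = 0..D. (- 1) powi (int r - int l) * ibinom (int r) (int l) *
        ibinom (int i - int l) (int t - int l) *
        ibinom (2 * int D + 1 + int l - int i - int r) (int j - int t - int r + int l))"

definition psd_on :: "nat set \<Rightarrow> (nat \<Rightarrow> nat \<Rightarrow> real) \<Rightarrow> bool" where
  "psd_on I M \<longleftrightarrow>
     (\<forall>i\<in>I. \<forall>j\<in>I. M i j = M j i) \<and>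
     (\<forall>v :: nat \<Rightarrow> real. 0 \<le> (\<Sum>i\<in>I. \<Sum>j\<in>I. v i * M i j * v j))"

text \<open>The variable $x^t_{i,j}$ is written \<open>x i j t\<close>; only its values on \<open>idx D\<close> matter.\<close>

definition sdp_feasible :: "nat \<Rightarrow> nat \<Rightarrow> (nat \<Rightarrow> nat \<Rightarrow> nat \<Rightarrow> real) \<Rightarrow> bool" where
  "sdp_feasible D d x \<longleftrightarrow>
     x 0 0 0 = 1 \<and>
     (\<forall>(i, j, t) \<in> idx D. 0 \<le> x i j t \<and> x i j t \<le> x i 0 0) \<and>
     (\<forall>(i, j, t) \<in> idx D. \<forall>(i', j', t') \<in> idx D.
        i + j - 2 * t \<le> D \<and>
        {#i', j', i' + j' - 2 * t'#} = {#i, j, i + j - 2 * t#} \<longrightarrow>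
        x i j t = x i' j' t') \<and>
     (\<forall>(i, j, t) \<in> idx D. \<forall>(i', j', t') \<in> idx D.
        D + 1 \<le> i + j - 2 * t \<and> i + j - 2 * t \<le> 2 * D \<and>
        {#i', j', 2 * D + 1 - (i' + j' - 2 * t')#} = {#i, j, 2 * D + 1 - (i + j - 2 * t)#} \<longrightarrow>
        x i j t = x i' j' t') \<and>
     (\<forall>(i, j, t) \<in> idx D.
        {i, j, i + j - 2 * t, 2 * D + 1 - (i + j - 2 * t)} \<inter> {1..d - 1} \<noteq> {} \<longrightarrow>
        x i j t = 0) \<and>
     (\<forall>r \<in> {0..D}.
        psd_on {r..D} (\<lambda>i j. \<Sum>t | (i, j, t) \<in> idx D. beta_coeff D r i j t * x i j t) \<and>
        psd_on {r..D} (\<lambda>i j. \<Sum>t | (i, j, t) \<in> idx D. beta_coeff D r i j t *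
          (x (min (i + j - 2 * t) (2 * D + 1 - (i + j - 2 * t))) 0 0 - x i j t)))"

definition sdp_objective :: "nat \<Rightarrow> (nat \<Rightarrow> nat \<Rightarrow> nat \<Rightarrow> real) \<Rightarrow> real" where
  "sdp_objective D x = (\<Sum>i = 0..D. real ((2 * D + 1) choose i) * x i 0 0)"

text \<open>The value is \<open>- \<infinity>\<close> if there is no feasible point. This happens for
  \<open>d \<ge> 2 * D + 2\<close>: the vanishing condition at \<open>i = j = t = 0\<close>, where
  \<open>2 * D + 1 - (i + j - 2 * t) = 2 * D + 1\<close>, then contradicts \<open>x 0 0 0 = 1\<close>.\<close>

definition sdp_value :: "nat \<Rightarrow> nat \<Rightarrow> ereal" where
  "sdp_value D d = (SUP x \<in> {x. sdp_feasible D d x}. ereal (sdp_objective D x))"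

end

theory Submission
  imports Defs "HOL-Combinatorics.Permutations"
begin

text \<open>
  From a code \<open>C\<close> one obtains a feasible point of value \<open>card C\<close>: view \<open>C\<close> as a
  complement-closed family of subsets of \<open>S = {1..2 * D + 1}\<close> and let \<open>x i j t\<close> be the average,
  over all permutations \<open>p\<close> of \<open>S\<close> and all members \<open>u\<close> of the family, of the indicator that
  \<open>u + p A\<close> and \<open>u + p B\<close> are members too, where \<open>card A = i\<close>, \<open>card B = j\<close>,
  \<open>card (A \<inter> B) = t\<close> and \<open>+\<close> is symmetric difference. Translating \<open>u\<close> gives the permutation
  symmetries. As kernels in \<open>(A, B)\<close> both \<open>x\<close> and its complement, where \<open>u\<close> ranges over the
  non-members, are averages of squares. The block with index \<open>r\<close> is the restriction of such a kernel to
  the functions that on each level agree up to a scalar with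
  \<open>A \<mapsto> \<Prod>s<r. [2 * s + 1 \<in> A] - [2 * s + 2 \<in> A]\<close>; every kernel depending only on sizes and
  intersection sizes maps this span to itself, with coefficients given by the numbers \<open>\<beta>\<close>.
\<close>

section \<open>Products of differences over disjoint pairs\<close>

text \<open>One element from each of the first \<open>r\<close> pairs
  \<open>{2 * s + 1, 2 * s + 2}\<close>; \<open>K\<close> records the pairs whose larger element is
  taken, so \<open>(- 1) ^ card K\<close> is the sign of the matching term when the product
  \<open>pair_sign\<close> is expanded.\<close>

definition pair_transversal :: "nat \<Rightarrow> nat set \<Rightarrow> nat set" where
  "pair_transversal r K = (\<lambda>s. if s \<in> K then 2 * s + 2 else 2 * s + 1) ` {..<r}"

text \<open>On sets of size \<open>r\<close> this is a polytabloid of a two-row shape with second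
  row of length \<open>r\<close>, a generator of the corresponding Specht module.\<close>

definition pair_sign :: "nat \<Rightarrow> nat set \<Rightarrow> real" where
  "pair_sign r A = (\<Prod>s<r. of_bool (2 * s + 1 \<in> A) - of_bool (2 * s + 2 \<in> A))"

text \<open>The \<open>r\<close>-th forward difference of \<open>h\<close> at \<open>0\<close>,
  written out because the alternating sum over \<open>l\<close> in \<open>beta_coeff\<close> has
  this shape.\<close>

definition fwd_diff :: "nat \<Rightarrow> (nat \<Rightarrow> real) \<Rightarrow> real" where
  "fwd_diff r h = (\<Sum>l\<le>r. (- 1) ^ (r - l) * real (r choose l) * h l)"

text \<open>Pascal's rule splits each coefficient; the term at \<open>l = 0\<close> is set apart
  since only one half of the rule reaches it.\<close>

lemma fwd_diff_Suc: "fwd_diff (Suc r) h = fwd_diff r (\<lambda>l. h (Suc l)) - fwd_diff r h"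
proof -
  have "fwd_diff (Suc r) h = (- 1) ^ Suc r * h 0 +
      (\<Sum>l\<le>r. (- 1) ^ (r - l) * real (Suc r choose Suc l) * h (Suc l))"
    unfolding fwd_diff_def by (subst sum.atMost_Suc_shift) simp
  also have "\<dots> = (- 1) ^ Suc r * h 0 + (\<Sum>l\<le>r. (- 1) ^ (r - l) * real (r choose l) * h (Suc l))
      + (\<Sum>l\<le>r. (- 1) ^ (r - l) * real (r choose Suc l) * h (Suc l))"
    by (simp add: algebra_simps sum.distrib)
  also have "(\<Sum>l\<le>r. (- 1) ^ (r - l) * real (r choose Suc l) * h (Suc l)) =
      (\<Sum>l<r. (- 1) ^ (r - l) * real (r choose Suc l) * h (Suc l))"
    by (subst lessThan_Suc_atMost[symmetric]) simp
  also have "\<dots> = - (\<Sum>l<r. (- 1) ^ (r - Suc l) * real (r choose Suc l) * h (Suc l))"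
  proof -
    have "(- 1) ^ (r - l) = - ((- 1) ^ (r - Suc l) :: real)" if "l < r" for l
      using that by (metis Suc_diff_Suc mult_minus1 power_Suc)
    then show ?thesis
      unfolding sum_negf[symmetric] by (intro sum.cong) simp_all
  qed
  also have "(\<Sum>l<r. (- 1) ^ (r - Suc l) * real (r choose Suc l) * h (Suc l)) =
      fwd_diff r h - (- 1) ^ r * h 0"
    unfolding fwd_diff_def lessThan_Suc_atMost[symmetric] by (subst sum.lessThan_Suc_shift) simp
  finally show ?thesis
    by (simp add: fwd_diff_def)
qed

lemma fwd_diff_diff: "fwd_diff r (\<lambda>l. g l - h l) = fwd_diff r g - fwd_diff r h"
  by (simp add: fwd_diff_def algebra_simps sum_subtractf)

lemma pair_transversal_Suc:
  "pair_transversal (Suc r) K = insert (if r \<in> K then 2 * r + 2 else 2 * r + 1) (pair_transversal r K)"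
  by (simp add: pair_transversal_def lessThan_Suc)

lemma pair_transversal_insert: "pair_transversal r (insert r K) = pair_transversal r K"
  by (force simp: pair_transversal_def)

lemma pair_transversal_bounds: "pair_transversal r K \<subseteq> {1..2 * r}"
  by (auto simp: pair_transversal_def)

lemma finite_pair_transversal [simp]: "finite (pair_transversal r K)"
  by (simp add: pair_transversal_def)

lemma card_pair_transversal: "card (pair_transversal r K) = r"
proof -
  have "inj_on (\<lambda>s. if s \<in> K then 2 * s + 2 else 2 * s + 1) {..<r}"
    by (rule inj_onI) (auto split: if_splits; presburger)
  then show ?thesis
    unfolding pair_transversal_def by (subst card_image) simp_all
qed

lemma sum_Pow_insert:
  assumes "finite F" "x \<notin> F"
  shows "(\<Sum>K\<in>Pow (insert x F). g K) = (\<Sum>K\<in>Pow F. g K) + (\<Sum>K\<in>Pow F. g (insert x K))"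
proof -
  have "inj_on (insert x) (Pow F)"
    using assms(2) by (auto simp: inj_on_def)
  moreover have "Pow F \<inter> insert x ` Pow F = {}"
    using assms(2) by auto
  ultimately show ?thesis
    using assms by (simp add: Pow_insert sum.union_disjoint sum.reindex)
qed

text \<open>Induction on \<open>r\<close>: taking the first or the second element of the last pair
  gives two sums of opposite sign. They cancel if \<open>A\<close> contains both or neither of these
  elements, where the new factor of \<open>pair_sign\<close> is zero; otherwise they combine, up to
  sign, to one more forward difference.\<close>

lemma sum_pair_transversal:
  "(\<Sum>K\<in>Pow {..<r}. (- 1) ^ card K * h (card (pair_transversal r K \<inter> A))) =
    pair_sign r A * fwd_diff r h"
proof (induction r arbitrary: h)
  case 0
  then show ?case
    by (simp add: pair_sign_def fwd_diff_def pair_transversal_def)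
next
  case (Suc r)
  have step: "card (insert y (pair_transversal r K) \<inter> A) =
      of_bool (y \<in> A) + card (pair_transversal r K \<inter> A)"
    if "y > 2 * r" for y K
  proof -
    have "y \<notin> pair_transversal r K \<inter> A"
      using that pair_transversal_bounds[of r K] by auto
    then show ?thesis
      by (cases "y \<in> A") (simp_all add: Int_insert_left)
  qed
  have "(\<Sum>K\<in>Pow {..<Suc r}. (- 1) ^ card K * h (card (pair_transversal (Suc r) K \<inter> A))) =
      (\<Sum>K\<in>Pow {..<r}. (- 1) ^ card K *
        h (of_bool (2 * r + 1 \<in> A) + card (pair_transversal r K \<inter> A)))
      + (\<Sum>K\<in>Pow {..<r}. - ((- 1) ^ card K *
        h (of_bool (2 * r + 2 \<in> A) + card (pair_transversal r K \<inter> A))))"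
    unfolding lessThan_Suc
  proof (subst sum_Pow_insert, simp, simp, intro arg_cong2[where f = "(+)"] sum.cong refl)
    fix K assume "K \<in> Pow {..<r}"
    then have K: "r \<notin> K" "finite K"
      by (auto intro: finite_subset)
    then show "(- 1) ^ card K * h (card (pair_transversal (Suc r) K \<inter> A)) =
        (- 1) ^ card K * h (of_bool (2 * r + 1 \<in> A) + card (pair_transversal r K \<inter> A))"
      by (simp add: pair_transversal_Suc step)
    show "(- 1) ^ card (insert r K) * h (card (pair_transversal (Suc r) (insert r K) \<inter> A)) =
        - ((- 1) ^ card K * h (of_bool (2 * r + 2 \<in> A) + card (pair_transversal r K \<inter> A)))"
      using K step[of "2 * r + 2" K] by (simp add: pair_transversal_Suc pair_transversal_insert)
  qed
  also have "\<dots> = pair_sign r A * (fwd_diff r (\<lambda>l. h (of_bool (2 * r + 1 \<in> A) + l))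
      - fwd_diff r (\<lambda>l. h (of_bool (2 * r + 2 \<in> A) + l)))"
    by (simp only: sum_negf Suc.IH[of "\<lambda>l. h (of_bool (_ \<in> A) + l)"] right_diff_distrib add_uminus_conv_diff)
  also have "\<dots> = pair_sign (Suc r) A * fwd_diff (Suc r) h"
    by (cases "2 * r + 1 \<in> A"; cases "2 * r + 2 \<in> A")
       (simp_all add: pair_sign_def fwd_diff_Suc algebra_simps)
  finally show ?case .
qed

text \<open>The indicator of \<open>l = r\<close> has \<open>r\<close>-th difference
  \<open>1\<close>, and a transversal, having \<open>r\<close> elements, meets \<open>A\<close> in
  \<open>r\<close> points only if it is contained in \<open>A\<close>.\<close>

lemma pair_sign_eq_sum:
  "pair_sign r A = (\<Sum>K\<in>Pow {..<r}. (- 1) ^ card K * of_bool (pair_transversal r K \<subseteq> A))"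
proof -
  have "fwd_diff r (\<lambda>l. of_bool (l = r)) = (\<Sum>l\<le>r. if l = r then 1 else 0)"
    unfolding fwd_diff_def by (intro sum.cong) auto
  then have 1: "fwd_diff r (\<lambda>l. of_bool (l = r)) = 1"
    by simp
  have 2: "card (pair_transversal r K \<inter> A) = r \<longleftrightarrow> pair_transversal r K \<subseteq> A" for K
    using card_subset_eq[of "pair_transversal r K" "pair_transversal r K \<inter> A"]
      card_pair_transversal[of r K] by (auto simp: Int_absorb2)
  show ?thesis
    using sum_pair_transversal[where h = "\<lambda>l. of_bool (l = r)" and r = r and A = A] by (simp add: 1 2)
qed

lemma pair_sign_pair_transversal:
  assumes "K \<subseteq> {..<r}"
  shows "pair_sign r (pair_transversal r K) = (- 1) ^ card K"
proof -
  have mem: "2 * s + 1 \<in> pair_transversal r K \<longleftrightarrow> s \<notin> K" "2 * s + 2 \<in> pair_transversal r K \<longleftrightarrow> s \<in> K"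
    if "s < r" for s
    using that unfolding pair_transversal_def image_iff by (auto split: if_splits; presburger)+
  have "pair_sign r (pair_transversal r K) = (\<Prod>s<r. if s \<in> K then - 1 else 1)"
    unfolding pair_sign_def by (intro prod.cong refl) (use mem in auto)
  also have "\<dots> = (\<Prod>s\<in>{..<r} \<inter> K. - 1)"
    by (subst prod.inter_restrict[symmetric]) simp_all
  also have "\<dots> = (- 1) ^ card K"
    using assms by (simp add: Int_absorb1)
  finally show ?thesis .
qed

section \<open>Sums over subsets of prescribed type\<close>

text \<open>Besides \<open>R\<close>, such a set \<open>B\<close> consists of a free choice inside
  \<open>A - R\<close> and a free choice inside \<open>S - A - R\<close>; the prescribed sizes fix
  how many elements each choice takes.\<close>

lemma card_supersets_of_type:
  assumes S: "finite S" and "A \<subseteq> S" "R \<subseteq> S" "t \<le> j"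
  shows "real (card {B. B \<subseteq> S \<and> card B = j \<and> card (A \<inter> B) = t \<and> R \<subseteq> B}) =
    ibinom (int (card A) - int (card (R \<inter> A))) (int t - int (card (R \<inter> A))) *
    ibinom (int (card S) + int (card (R \<inter> A)) - int (card A) - int (card R))
      (int j - int t - int (card R) + int (card (R \<inter> A)))"
proof -
  define l where "l = card (R \<inter> A)"
  define P where "P = A - R"
  define Q where "Q = S - A - R"
  let ?B = "{B. B \<subseteq> S \<and> card B = j \<and> card (A \<inter> B) = t \<and> R \<subseteq> B}"
  have fin: "finite A" "finite R" "finite P" "finite Q"
    using assms finite_subset unfolding P_def Q_def by blast+
  have cR: "card R = l + card (R - A)"
    using card_Int_Diff[OF fin(2), of A] by (simp add: l_def)
  have cP: "card P + l = card A"
    using card_Int_Diff[OF fin(1), of R] by (simp add: l_def P_def Int_commute)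
  have cQ: "card Q + card (R - A) + card A = card S"
  proof -
    have "card S = card A + card (S - A)"
      using card_Int_Diff[OF S, of A] assms(2) by (simp add: Int_absorb1)
    moreover have "card (S - A) = card (R - A) + card Q"
    proof -
      have "(S - A) \<inter> R = R - A"
        using assms(3) by blast
      then show ?thesis
        using card_Int_Diff[of "S - A" R] S by (simp add: Q_def)
    qed
    ultimately show ?thesis by simp
  qed
  \<comment> \<open>In the first case the natural-number differences \<open>m\<close> and
    \<open>n\<close> below are exact. In the second no \<open>B\<close> exists and a lower index is
    negative, so \<open>ibinom\<close> returns its default value \<open>0\<close>.\<close>
  show ?thesis
  proof (cases "l \<le> t \<and> card (R - A) \<le> j - t")
    case True
    define m where "m = t - l"
    define n where "n = j - t - card (R - A)"
    have mn: "t = l + m" "j = t + card (R - A) + n"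
      using True assms(4) by (auto simp: m_def n_def)
    let ?X = "{X. X \<subseteq> P \<and> card X = m}" and ?Y = "{Y. Y \<subseteq> Q \<and> card Y = n}"
    have "bij_betw (\<lambda>(X, Y). X \<union> Y \<union> R) (?X \<times> ?Y) ?B"
    proof (rule bij_betw_byWitness[where f' = "\<lambda>B. (B \<inter> P, B \<inter> Q)"])
      show "\<forall>z\<in>?X \<times> ?Y. (\<lambda>B. (B \<inter> P, B \<inter> Q)) ((\<lambda>(X, Y). X \<union> Y \<union> R) z) = z"
        by (auto simp: P_def Q_def)
      show "\<forall>B\<in>?B. (\<lambda>(X, Y). X \<union> Y \<union> R) ((\<lambda>B. (B \<inter> P, B \<inter> Q)) B) = B"
        by (auto simp: P_def Q_def)
      show "(\<lambda>(X, Y). X \<union> Y \<union> R) ` (?X \<times> ?Y) \<subseteq> ?B"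
      proof safe
        fix X Y assume X: "X \<subseteq> P" "m = card X" and Y: "Y \<subseteq> Q" "n = card Y"
        have f: "finite X" "finite Y" using X Y fin finite_subset by blast+
        have "A \<inter> (X \<union> Y \<union> R) = X \<union> (R \<inter> A)"
          using X Y by (auto simp: P_def Q_def)
        moreover have "card (X \<union> (R \<inter> A)) = m + l"
          unfolding l_def X(2) using X f fin by (intro card_Un_disjoint) (auto simp: P_def)
        ultimately show "card (A \<inter> (X \<union> Y \<union> R)) = t" using mn by simp
        have "card (X \<union> Y \<union> R) = card X + card Y + card R"
          using X Y f fin by (subst card_Un_disjoint, auto simp: P_def Q_def)+
        then show "card (X \<union> Y \<union> R) = j" using mn cR X(2) Y(2) by simp
      qed (use assms in \<open>auto simp: P_def Q_def\<close>)
      show "(\<lambda>B. (B \<inter> P, B \<inter> Q)) ` ?B \<subseteq> ?X \<times> ?Y"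
      proof safe
        fix B assume B: "B \<subseteq> S" "j = card B" "t = card (A \<inter> B)" "R \<subseteq> B"
        have f: "finite B" using B S finite_subset by blast
        have "A \<inter> B = (B \<inter> P) \<union> (R \<inter> A)" using B by (auto simp: P_def)
        moreover have "card ((B \<inter> P) \<union> (R \<inter> A)) = card (B \<inter> P) + l"
          unfolding l_def using fin by (intro card_Un_disjoint) (auto simp: P_def)
        ultimately show 1: "card (B \<inter> P) = m" using mn B(3) by simp
        have "B = (B \<inter> P) \<union> (B \<inter> Q) \<union> R" using B by (auto simp: P_def Q_def)
        moreover have "card ((B \<inter> P) \<union> (B \<inter> Q) \<union> R) = card (B \<inter> P) + card (B \<inter> Q) + card R"
          using f fin by (subst card_Un_disjoint, auto simp: P_def Q_def)+
        ultimately show "card (B \<inter> Q) = n" using mn B(2) 1 cR by simp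
      qed
    qed
    then have "card ?B = card (?X \<times> ?Y)"
      by (simp add: bij_betw_same_card)
    also have "\<dots> = (card P choose m) * (card Q choose n)"
      using fin by (simp add: card_cartesian_product n_subsets)
    finally have "real (card ?B) = ibinom (int (card P)) (int m) * ibinom (int (card Q)) (int n)"
      by (simp add: ibinom_def binomial_eq_0)
    then show ?thesis
      using mn cP cQ cR unfolding l_def[symmetric]
      by (smt (verit) of_nat_add)
  next
    case False
    have "?B = {}"
    proof (rule ccontr)
      assume "?B \<noteq> {}"
      then obtain B where B: "B \<subseteq> S" "card B = j" "card (A \<inter> B) = t" "R \<subseteq> B" by blast
      have f: "finite B" using B S finite_subset by blast
      have "l \<le> t"
        unfolding l_def B(3)[symmetric] using fin B(4) by (intro card_mono) auto
      moreover have "card (R - A) \<le> card (B - A)"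
        using f B(4) by (intro card_mono) auto
      moreover have "card B = card (B \<inter> A) + card (B - A)"
        using card_Int_Diff[OF f] .
      ultimately show False using False B by (simp add: Int_commute)
    qed
    have "int t - int l < 0 \<or> int j - int t - int (card R) + int l < 0"
      using False cR assms(4) by auto
    then have zero: "ibinom (int (card A) - int l) (int t - int l) *
        ibinom (int (card S) + int l - int (card A) - int (card R))
          (int j - int t - int (card R) + int l) = 0"
      by (auto simp: ibinom_def)
    show ?thesis
      unfolding l_def[symmetric] zero \<open>?B = {}\<close> by simp
  qed
qed


text \<open>The sum over \<open>l\<close> from \<open>beta_coeff\<close> without its leading
  binomial, for a ground set of any size \<open>n\<close>.\<close>

definition type_coeff :: "nat \<Rightarrow> nat \<Rightarrow> nat \<Rightarrow> nat \<Rightarrow> nat \<Rightarrow> real" where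
  "type_coeff n r i j t = fwd_diff r (\<lambda>l. ibinom (int i - int l) (int t - int l) *
     ibinom (int n + int l - int i - int r) (int j - int t - int r + int l))"

text \<open>Expanding \<open>pair_sign r B\<close> over transversals \<open>R \<subseteq> B\<close>, the number of admissible supersets of
  \<open>R\<close> depends on \<open>R\<close> only through \<open>card (R \<inter> A)\<close>, so \<open>sum_pair_transversal\<close> applies:
  \<open>pair_sign r\<close> is an eigenvector up to the change of level from \<open>j\<close> to \<open>card A\<close>.\<close>

lemma sum_pair_sign_of_type:
  assumes "2 * r \<le> n" "A \<subseteq> {1..n}" "t \<le> j"
  shows "(\<Sum>B | B \<subseteq> {1..n} \<and> card B = j \<and> card (A \<inter> B) = t. pair_sign r B) =
    pair_sign r A * type_coeff n r (card A) j t"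
proof -
  let ?F = "{B. B \<subseteq> {1..n} \<and> card B = j \<and> card (A \<inter> B) = t}"
  define h where "h = (\<lambda>l. ibinom (int (card A) - int l) (int t - int l) *
     ibinom (int n + int l - int (card A) - int r) (int j - int t - int r + int l))"
  have fin: "finite ?F"
    by (rule finite_subset[of _ "Pow {1..n}"]) auto
  have count: "(\<Sum>B\<in>?F. of_bool (pair_transversal r K \<subseteq> B)) =
      h (card (pair_transversal r K \<inter> A))" for K
  proof -
    have sub: "pair_transversal r K \<subseteq> {1..n}"
      using pair_transversal_bounds[of r K] assms(1) by fastforce
    have "(\<Sum>B\<in>?F. of_bool (pair_transversal r K \<subseteq> B)) =
        real (card (?F \<inter> {B. pair_transversal r K \<subseteq> B}))"
      using fin by (simp add: sum_of_bool_eq)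
    also have "?F \<inter> {B. pair_transversal r K \<subseteq> B} =
        {B. B \<subseteq> {1..n} \<and> card B = j \<and> card (A \<inter> B) = t \<and> pair_transversal r K \<subseteq> B}"
      by blast
    also have "real (card \<dots>) = h (card (pair_transversal r K \<inter> A))"
      using card_supersets_of_type[OF _ assms(2) sub assms(3)]
      by (simp add: h_def card_pair_transversal)
    finally show ?thesis .
  qed
  have "(\<Sum>B\<in>?F. pair_sign r B) =
      (\<Sum>K\<in>Pow {..<r}. (- 1) ^ card K * (\<Sum>B\<in>?F. of_bool (pair_transversal r K \<subseteq> B)))"
    unfolding pair_sign_eq_sum sum_distrib_left by (rule sum.swap)
  also have "\<dots> = pair_sign r A * fwd_diff r h"
    unfolding count by (rule sum_pair_transversal)
  finally show ?thesis
    by (simp add: type_coeff_def h_def)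
qed

section \<open>Norms of the signed products on each level\<close>

text \<open>Pascal's rule for every integer \<open>b\<close>. At \<open>a = - 1\<close>,
  \<open>b = - 1\<close> it would fail: the left side is \<open>1\<close>, the right side
  \<open>0\<close>.\<close>

lemma ibinom_Suc_Suc:
  assumes "0 \<le> a"
  shows "ibinom (a + 1) (b + 1) = ibinom a b + ibinom a (b + 1)"
proof -
  obtain n where a: "a = int n"
    using assms nonneg_int_cases by blast
  consider "b < - 1" | "b = - 1" | k where "b = int k"
    by (cases "0 \<le> b") (auto elim: nonneg_int_cases, linarith)
  then show ?thesis
  proof cases
    case 3
    then show ?thesis
      using a by (auto simp: ibinom_def binomial_eq_0 nat_add_distrib)
  qed (auto simp: ibinom_def a)
qed

text \<open>By Pascal's rule, one difference step in both indices at once leaves the upper index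
  alone and raises the lower one by \<open>1\<close>.\<close>

lemma fwd_diff_ibinom:
  assumes "0 \<le> a"
  shows "fwd_diff r (\<lambda>l. ibinom (a + int l) (b + int l)) = ibinom a (b + int r)"
proof (induction r arbitrary: b)
  case 0
  then show ?case by (simp add: fwd_diff_def)
next
  case (Suc r)
  have "ibinom (a + int (Suc l)) (b + int (Suc l)) - ibinom (a + int l) (b + int l) =
      ibinom (a + int l) (b + 1 + int l)" for l
    using ibinom_Suc_Suc[of "a + int l" "b + int l"] assms by (simp add: algebra_simps)
  then show ?case
    using Suc.IH[of "b + 1"] by (simp add: fwd_diff_Suc flip: fwd_diff_diff) (simp add: algebra_simps)
qed

text \<open>Expand one of the two factors over transversals. The inner sum over the sets containing
  a fixed transversal is an instance of \<open>sum_pair_sign_of_type\<close>, with the transversal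
  as first set and \<open>t = r\<close>. The two signs multiply to \<open>1\<close>, and there are
  \<open>2 ^ r\<close> transversals.\<close>

lemma sum_pair_sign_square:
  assumes "2 * r \<le> n" "r \<le> i"
  shows "(\<Sum>A | A \<subseteq> {1..n} \<and> card A = i. (pair_sign r A)\<^sup>2) =
    2 ^ r * ibinom (int n - 2 * int r) (int i - int r)"
proof -
  let ?F = "{A. A \<subseteq> {1..n} \<and> card A = i}"
  let ?R = "pair_transversal r"
  have fin: "finite ?F"
    by (rule finite_subset[of _ "Pow {1..n}"]) auto
  have sub: "?R K \<subseteq> {1..n}" for K
    using pair_transversal_bounds[of r K] assms(1) by fastforce
  \<comment> \<open>For \<open>l \<le> r\<close> the first binomial is
    \<open>ibinom (r - l) (r - l) = 1\<close>, so only a difference of the second one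
    remains.\<close>
  have coeff: "type_coeff n r r i r = ibinom (int n - 2 * int r) (int i - int r)"
  proof -
    have "type_coeff n r r i r =
        fwd_diff r (\<lambda>l. ibinom (int n - 2 * int r + int l) (int i - 2 * int r + int l))"
      unfolding type_coeff_def fwd_diff_def
      by (intro sum.cong refl) (auto simp: ibinom_def algebra_simps)
    then show ?thesis
      using fwd_diff_ibinom[of "int n - 2 * int r" r "int i - 2 * int r"] assms(1) by simp
  qed
  have inner: "(\<Sum>A\<in>?F. of_bool (?R K \<subseteq> A) * pair_sign r A) =
      (- 1) ^ card K * ibinom (int n - 2 * int r) (int i - int r)" if "K \<subseteq> {..<r}" for K
  proof -
    have iff: "card (?R K \<inter> A) = r \<longleftrightarrow> ?R K \<subseteq> A" for A
      using card_subset_eq[of "?R K" "?R K \<inter> A"] card_pair_transversal[of r K]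
      by (auto simp: Int_absorb2)
    have "(\<Sum>A\<in>?F. of_bool (?R K \<subseteq> A) * pair_sign r A) = (\<Sum>A\<in>?F \<inter> {A. ?R K \<subseteq> A}. pair_sign r A)"
      by (subst sum.inter_restrict[OF fin], intro sum.cong refl) simp
    also have "?F \<inter> {A. ?R K \<subseteq> A} = {A. A \<subseteq> {1..n} \<and> card A = i \<and> card (?R K \<inter> A) = r}"
      by (auto simp: iff)
    finally show ?thesis
      using sum_pair_sign_of_type[OF assms(1) sub assms(2)] that
      by (simp add: card_pair_transversal coeff pair_sign_pair_transversal)
  qed
  have "(\<Sum>A\<in>?F. (pair_sign r A)\<^sup>2) =
      (\<Sum>A\<in>?F. \<Sum>K\<in>Pow {..<r}. (- 1) ^ card K * (of_bool (?R K \<subseteq> A) * pair_sign r A))"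
    by (subst power2_eq_square, subst (1) pair_sign_eq_sum)
       (simp add: sum_distrib_right mult.assoc del: sum_mult_of_bool_eq sum_of_bool_mult_eq)
  also have "\<dots> = (\<Sum>K\<in>Pow {..<r}. (- 1) ^ card K * (\<Sum>A\<in>?F. of_bool (?R K \<subseteq> A) * pair_sign r A))"
    unfolding sum_distrib_left by (rule sum.swap)
  also have "\<dots> = (\<Sum>K\<in>Pow {..<r}. ibinom (int n - 2 * int r) (int i - int r))"
    by (intro sum.cong refl) (simp only: inner Pow_iff, simp flip: mult.assoc power_add mult_2)
  finally show ?thesis
    by (simp add: card_Pow)
qed

section \<open>Positive semidefiniteness\<close>

text \<open>The terms with \<open>l > r\<close> vanish through the factor \<open>ibinom r l\<close>,
  which leaves exactly an \<open>r\<close>-th forward difference.\<close>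

lemma beta_coeff_eq:
  assumes "r \<le> D"
  shows "beta_coeff D r i j t =
    ibinom (2 * int D + 1 - 2 * int r) (int i - int r) * type_coeff (2 * D + 1) r i j t"
proof -
  let ?g = "\<lambda>l. ibinom (int i - int l) (int t - int l) *
    ibinom (2 * int D + 1 + int l - int i - int r) (int j - int t - int r + int l)"
  have "(\<Sum>l = 0..D. (- 1) powi (int r - int l) * ibinom (int r) (int l) * ?g l) =
      (\<Sum>l\<le>r. (- 1) powi (int r - int l) * ibinom (int r) (int l) * ?g l)"
    using assms by (intro sum.mono_neutral_right) (auto simp: ibinom_def)
  also have "\<dots> = (\<Sum>l\<le>r. (- 1) ^ (r - l) * real (r choose l) * ?g l)"
    by (intro sum.cong refl) (simp add: ibinom_def flip: of_nat_diff)
  finally show ?thesis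
    by (simp add: beta_coeff_def type_coeff_def fwd_diff_def mult.assoc add.commute[of 1])
qed

text \<open>Sorting the sets \<open>B\<close> by \<open>t = card (A \<inter> B)\<close> makes each
  inner sum a multiple of \<open>pair_sign r A\<close>. What is left is the sum of squares of
  \<open>pair_sign r\<close> on level \<open>i\<close>, which supplies the leading binomial of
  \<open>beta_coeff\<close> and the factor \<open>2 ^ r\<close>.\<close>

lemma sum_beta_coeff:
  assumes "r \<le> i" "r \<le> j" "i \<le> D" "j \<le> D"
  shows "2 ^ r * (\<Sum>t | (i, j, t) \<in> idx D. beta_coeff D r i j t * m t) =
    (\<Sum>A | A \<subseteq> {1..2 * D + 1} \<and> card A = i. \<Sum>B | B \<subseteq> {1..2 * D + 1} \<and> card B = j.
      pair_sign r A * m (card (A \<inter> B)) * pair_sign r B)"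
proof -
  let ?S = "{1..2 * D + 1}"
  let ?F = "\<lambda>i. {A. A \<subseteq> ?S \<and> card A = i}"
  let ?T = "{t. (i, j, t) \<in> idx D}"
  have fin: "finite (?F k)" for k
    by (rule finite_subset[of _ "Pow ?S"]) auto
  \<comment> \<open>For \<open>i, j \<le> D\<close> the condition
    \<open>i + j - t \<le> 2 * D\<close> holds automatically.\<close>
  have T: "?T = {..min i j}"
    using assms by (auto simp: idx_def)
  have inner: "(\<Sum>B\<in>?F j. m (card (A \<inter> B)) * pair_sign r B) =
      (\<Sum>t\<in>?T. m t * (pair_sign r A * type_coeff (2 * D + 1) r i j t))" if "A \<in> ?F i" for A
  proof -
    have A: "A \<subseteq> ?S" "card A = i" "finite A"
      using that finite_subset by auto
    have "(\<lambda>B. card (A \<inter> B)) ` ?F j \<subseteq> ?T"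
    proof safe
      fix B assume B: "B \<subseteq> ?S" "j = card B"
      have "card (A \<inter> B) \<le> card A" "card (A \<inter> B) \<le> card B"
        using A B by (auto intro!: card_mono intro: finite_subset)
      then show "(i, card B, card (A \<inter> B)) \<in> idx D"
        using assms A(2) B(2) by (auto simp: idx_def)
    qed
    then have "(\<Sum>B\<in>?F j. m (card (A \<inter> B)) * pair_sign r B) =
        (\<Sum>t\<in>?T. \<Sum>B | B \<in> ?F j \<and> card (A \<inter> B) = t. m (card (A \<inter> B)) * pair_sign r B)"
      by (intro sum.group[symmetric] fin) (simp_all add: T)
    also have "\<dots> = (\<Sum>t\<in>?T. m t * (\<Sum>B | B \<subseteq> ?S \<and> card B = j \<and> card (A \<inter> B) = t. pair_sign r B))"
      unfolding sum_distrib_left by (intro sum.cong refl) auto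
    also have "\<dots> = (\<Sum>t\<in>?T. m t * (pair_sign r A * type_coeff (2 * D + 1) r i j t))"
    proof (intro sum.cong refl)
      fix t assume "t \<in> ?T"
      then have "t \<le> j"
        by (simp add: T)
      then show "m t * (\<Sum>B | B \<subseteq> ?S \<and> card B = j \<and> card (A \<inter> B) = t. pair_sign r B) =
          m t * (pair_sign r A * type_coeff (2 * D + 1) r i j t)"
        using sum_pair_sign_of_type[of r "2 * D + 1" A t j] assms A by simp
    qed
    finally show ?thesis .
  qed
  have "(\<Sum>A\<in>?F i. \<Sum>B\<in>?F j. pair_sign r A * m (card (A \<inter> B)) * pair_sign r B) =
      (\<Sum>A\<in>?F i. pair_sign r A * (\<Sum>B\<in>?F j. m (card (A \<inter> B)) * pair_sign r B))"
    by (simp add: sum_distrib_left mult.assoc)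
  also have "\<dots> = (\<Sum>A\<in>?F i. \<Sum>t\<in>?T. (pair_sign r A)\<^sup>2 * (m t * type_coeff (2 * D + 1) r i j t))"
    by (intro sum.cong refl)
       (simp only: inner, simp add: sum_distrib_left power2_eq_square algebra_simps)
  also have "\<dots> = (\<Sum>t\<in>?T. (\<Sum>A\<in>?F i. (pair_sign r A)\<^sup>2) * (m t * type_coeff (2 * D + 1) r i j t))"
    unfolding sum_distrib_right by (rule sum.swap)
  also have "(\<Sum>A\<in>?F i. (pair_sign r A)\<^sup>2) = 2 ^ r * ibinom (2 * int D + 1 - 2 * int r) (int i - int r)"
    using sum_pair_sign_square[of r "2 * D + 1" i] assms by (simp add: add.commute[of 1])
  also have "(\<Sum>t\<in>?T. 2 ^ r * ibinom (2 * int D + 1 - 2 * int r) (int i - int r) *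
        (m t * type_coeff (2 * D + 1) r i j t)) =
      2 ^ r * (\<Sum>t\<in>?T. beta_coeff D r i j t * m t)"
    using assms by (simp add: sum_distrib_left beta_coeff_eq algebra_simps)
  finally show ?thesis
    by simp
qed

text \<open>The block with index \<open>r\<close> is the restriction of the form \<open>M\<close> to the span of the
  restrictions of \<open>pair_sign r\<close> to the levels \<open>r, \<dots>, D\<close>.\<close>

lemma psd_on_beta_coeff:
  assumes sym: "\<And>A B. M A B = M B A"
    and psd: "\<And>f :: nat set \<Rightarrow> real. 0 \<le> (\<Sum>A\<in>Pow {1..2 * D + 1}. \<Sum>B\<in>Pow {1..2 * D + 1}. f A * M A B * f B)"
    and m: "\<And>A B. A \<subseteq> {1..2 * D + 1} \<Longrightarrow> B \<subseteq> {1..2 * D + 1} \<Longrightarrow> card A \<le> D \<Longrightarrow> card B \<le> D \<Longrightarrow>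
      m (card A) (card B) (card (A \<inter> B)) = M A B"
  shows "psd_on {r..D} (\<lambda>i j. \<Sum>t | (i, j, t) \<in> idx D. beta_coeff D r i j t * m i j t)"
    (is "psd_on _ ?b")
proof -
  let ?S = "{1..2 * D + 1}"
  let ?F = "\<lambda>i. {A. A \<subseteq> ?S \<and> card A = i}"
  have fin: "finite (?F k)" for k
    by (rule finite_subset[of _ "Pow ?S"]) auto
  have block: "2 ^ r * ?b i j = (\<Sum>A\<in>?F i. \<Sum>B\<in>?F j. pair_sign r A * M A B * pair_sign r B)"
    if "i \<in> {r..D}" "j \<in> {r..D}" for i j
    using that m by (subst sum_beta_coeff) (auto intro!: sum.cong)
  have "?b i j = ?b j i" if "i \<in> {r..D}" "j \<in> {r..D}" for i j
  proof -
    have "2 ^ r * ?b i j = (\<Sum>B\<in>?F j. \<Sum>A\<in>?F i. pair_sign r A * M A B * pair_sign r B)"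
      unfolding block[OF that] by (rule sum.swap)
    also have "\<dots> = 2 ^ r * ?b j i"
      unfolding block[OF that(2) that(1)] by (intro sum.cong refl) (simp add: sym algebra_simps)
    finally show ?thesis
      by simp
  qed
  moreover have "0 \<le> (\<Sum>i\<in>{r..D}. \<Sum>j\<in>{r..D}. v i * ?b i j * v j)" for v
  proof -
    \<comment> \<open>The vector \<open>v\<close> is lifted to subsets along
      \<open>pair_sign r\<close>; the form \<open>M\<close> at \<open>f\<close> is then
      \<open>2 ^ r\<close> times the form of the block at \<open>v\<close>.\<close>
    define f where "f A = (if card A \<in> {r..D} then v (card A) * pair_sign r A else 0)" for A
    have levels: "(\<Sum>A\<in>Pow ?S. f A * g A) =
        (\<Sum>i\<in>{r..D}. \<Sum>A\<in>?F i. v i * pair_sign r A * g A)" for g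
    proof -
      have "(\<Sum>A\<in>Pow ?S. f A * g A) = (\<Sum>A\<in>{A \<in> Pow ?S. card A \<in> {r..D}}. f A * g A)"
        by (intro sum.mono_neutral_right) (auto simp: f_def)
      also have "\<dots> = (\<Sum>i\<in>{r..D}. \<Sum>A | A \<in> {A \<in> Pow ?S. card A \<in> {r..D}} \<and> card A = i. f A * g A)"
        by (intro sum.group[symmetric]) auto
      also have "\<dots> = (\<Sum>i\<in>{r..D}. \<Sum>A\<in>?F i. v i * pair_sign r A * g A)"
        by (intro sum.cong) (auto simp: f_def)
      finally show ?thesis .
    qed
    have "(\<Sum>A\<in>Pow ?S. \<Sum>B\<in>Pow ?S. f A * M A B * f B) =
        (\<Sum>A\<in>Pow ?S. f A * (\<Sum>B\<in>Pow ?S. f B * M A B))"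
      by (simp add: sum_distrib_left algebra_simps)
    also have "\<dots> = (\<Sum>i\<in>{r..D}. \<Sum>A\<in>?F i. \<Sum>j\<in>{r..D}. \<Sum>B\<in>?F j.
        v i * v j * (pair_sign r A * M A B * pair_sign r B))"
      unfolding levels by (simp add: sum_distrib_left algebra_simps)
    also have "\<dots> = (\<Sum>i\<in>{r..D}. \<Sum>j\<in>{r..D}. \<Sum>A\<in>?F i. \<Sum>B\<in>?F j.
        v i * v j * (pair_sign r A * M A B * pair_sign r B))"
      by (intro sum.cong refl sum.swap)
    also have "\<dots> = (\<Sum>i\<in>{r..D}. \<Sum>j\<in>{r..D}. v i * v j * (2 ^ r * ?b i j))"
      by (intro sum.cong refl) (simp only: block, simp only: sum_distrib_left)
    also have "\<dots> = 2 ^ r * (\<Sum>i\<in>{r..D}. \<Sum>j\<in>{r..D}. v i * ?b i j * v j)"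
      by (simp only: sum_distrib_left mult_ac)
    finally have "0 \<le> 2 ^ r * (\<Sum>i\<in>{r..D}. \<Sum>j\<in>{r..D}. v i * ?b i j * v j)"
      using psd[of f] by linarith
    moreover have "0 \<le> x" if "0 \<le> 2 ^ r * x" for x :: real
      using that mult_le_cancel_left_pos[of "2 ^ r :: real" 0 x] by simp
    ultimately show ?thesis
      by blast
  qed
  ultimately show ?thesis
    unfolding psd_on_def by blast
qed


text \<open>Moving the sum over \<open>p\<close> outside gives a weighted sum of squares.\<close>

lemma sum_gram_nonneg:
  fixes w :: "'p \<Rightarrow> real"
  assumes "\<And>p. p \<in> P \<Longrightarrow> 0 \<le> w p"
  shows "0 \<le> (\<Sum>A\<in>F. \<Sum>B\<in>F. f A * (\<Sum>p\<in>P. w p * g p A * g p B) * f B)"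
proof -
  have "(\<Sum>A\<in>F. \<Sum>B\<in>F. f A * (\<Sum>p\<in>P. w p * g p A * g p B) * f B) =
      (\<Sum>A\<in>F. \<Sum>B\<in>F. \<Sum>p\<in>P. w p * ((f A * g p A) * (f B * g p B)))"
    by (simp add: sum_distrib_left sum_distrib_right algebra_simps)
  also have "\<dots> = (\<Sum>A\<in>F. \<Sum>p\<in>P. \<Sum>B\<in>F. w p * ((f A * g p A) * (f B * g p B)))"
    by (intro sum.cong refl sum.swap)
  also have "\<dots> = (\<Sum>p\<in>P. \<Sum>A\<in>F. \<Sum>B\<in>F. w p * ((f A * g p A) * (f B * g p B)))"
    by (rule sum.swap)
  also have "\<dots> = (\<Sum>p\<in>P. w p * (\<Sum>A\<in>F. f A * g p A)\<^sup>2)"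
    unfolding power2_eq_square sum_product by (simp only: sum_distrib_left)
  finally show ?thesis
    using assms by (simp add: sum_nonneg)
qed

section \<open>Symmetrised triple counts of a code\<close>

text \<open>Each point is labelled by the cell of the Venn diagram it lies in. The three
  cardinalities determine the sizes of all four cells, and equal multisets of labels yield a
  label-preserving permutation.\<close>

lemma exists_permutation_of_type:
  assumes S: "finite S" and sub: "A \<subseteq> S" "B \<subseteq> S" "A' \<subseteq> S" "B' \<subseteq> S"
    and cards: "card A = card A'" "card B = card B'" "card (A \<inter> B) = card (A' \<inter> B')"
  obtains p where "p permutes S" "p ` A = A'" "p ` B = B'"
proof -
  define f where "f A B x = (x \<in> A, x \<in> B)" for A B and x :: 'a
  have count: "count (image_mset (f A B) (mset_set S)) y =
      (case y of (True, True) \<Rightarrow> card (A \<inter> B) | (True, False) \<Rightarrow> card A - card (A \<inter> B)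
        | (False, True) \<Rightarrow> card B - card (A \<inter> B)
        | (False, False) \<Rightarrow> card S - (card A + card B - card (A \<inter> B)))"
    if "A \<subseteq> S" "B \<subseteq> S" for A B y
  proof -
    have fin: "finite A" "finite B"
      using that S finite_subset by blast+
    have un: "card (A \<union> B) = card A + card B - card (A \<inter> B)"
      using card_Un_Int[OF fin] by simp
    have "count (image_mset (f A B) (mset_set S)) y = card {x \<in> S. f A B x = y}"
      using S by (simp add: count_image_mset vimage_def Int_def conj_commute)
    also have "{x \<in> S. f A B x = y} = (case y of (True, True) \<Rightarrow> A \<inter> B | (True, False) \<Rightarrow> A - A \<inter> B
        | (False, True) \<Rightarrow> B - A \<inter> B | (False, False) \<Rightarrow> S - (A \<union> B))"
      using that by (auto simp: f_def split: prod.splits bool.splits)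
    finally show ?thesis
      using that fin S by (auto split: prod.splits bool.splits
          simp: card_Diff_subset finite_subset un simp del: Diff_Int)
  qed
  have "image_mset (f A B) (mset_set S) = image_mset (f A' B') (mset_set S)"
    by (rule multiset_eqI) (simp only: count sub cards)
  then obtain p where p: "p permutes S" "\<forall>x\<in>S. f A B x = f A' B' (p x)"
    using image_mset_eq_implies_permutes[OF S] by metis
  then have iff: "x \<in> A \<longleftrightarrow> p x \<in> A'" "x \<in> B \<longleftrightarrow> p x \<in> B'" if "x \<in> S" for x
    using that by (auto simp: f_def)
  have img: "p ` E = E'" if "E \<subseteq> S" "E' \<subseteq> S" "\<And>x. x \<in> S \<Longrightarrow> x \<in> E \<longleftrightarrow> p x \<in> E'" for E E'
  proof (intro equalityI subsetI)
    fix y assume "y \<in> p ` E"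
    then show "y \<in> E'"
      using that by auto
  next
    fix y assume y: "y \<in> E'"
    then have "y \<in> p ` S"
      using that(2) permutes_image[OF p(1)] by auto
    then show "y \<in> p ` E"
      using that(3) y by auto
  qed
  show thesis
    using that[OF p(1)] img[OF sub(1,3)] img[OF sub(2,4)] iff by simp
qed

lemma mset_triple_eqE:
  assumes "{#a, b, c#} = {#x, y, z#}"
  obtains "a = x" "b = y" "c = z" | "a = x" "b = z" "c = y" | "a = y" "b = x" "c = z"
    | "a = y" "b = z" "c = x" | "a = z" "b = x" "c = y" | "a = z" "b = y" "c = x"
proof -
  have pair: "b = y \<and> c = z \<or> b = z \<and> c = y" if "{#b, c#} = {#y, z#}" for b c y z :: 'a
    using that by (auto simp: add_eq_conv_diff split: if_splits)
  have "a \<in># {#x, y, z#}"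
    using assms by (metis union_single_eq_member)
  then consider "a = x" | "a = y" | "a = z"
    by auto
  then show thesis
  proof cases
    case 1
    then show thesis
      using assms pair[of b c y z] that by auto
  next
    case 2
    then show thesis
      using assms pair[of b c x z] that by (auto simp: add_mset_commute[of x y])
  next
    case 3
    have "{#x, y, z#} = {#z, x, y#}"
      by simp
    then show thesis
      using assms pair[of b c x y] that 3 by (metis add_mset_add_mset_same_iff)
  qed
qed

section \<open>Codes as complement-closed families of sets\<close>

text \<open>\<open>code_nonempty\<close> keeps the normalising constant positive;
  \<open>d_le\<close> keeps the size \<open>2 * D + 1\<close>, which occurs when the symmetric
  difference is empty, out of the forbidden range \<open>{1..d - 1}\<close>.\<close>

locale folded_code =
  fixes D d :: nat and C :: "nat set set set"
  assumes code_subset: "C \<subseteq> folded_verts D"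
    and code_dist: "\<And>x y. x \<in> C \<Longrightarrow> y \<in> C \<Longrightarrow> x \<noteq> y \<Longrightarrow> d \<le> folded_dist x y"
    and code_nonempty: "C \<noteq> {}"
    and d_le: "d \<le> 2 * D + 1"
begin

abbreviation ground :: "nat set" where
  "ground \<equiv> {1..2 * D + 1}"

definition ind :: "nat set \<Rightarrow> real" where
  "ind u = of_bool ({u, ground - u} \<in> C)"

lemma ind_nonneg: "0 \<le> ind u" and ind_le_1: "ind u \<le> 1" and ind_square: "ind u * ind u = ind u"
  by (simp_all add: ind_def)

lemma ind_compl: "u \<subseteq> ground \<Longrightarrow> ind (ground - u) = ind u"
  by (simp add: ind_def double_diff insert_commute)

lemma folded_vertE:
  assumes "x \<in> folded_verts D"
  obtains u where "u \<subseteq> ground" "x = {u, ground - u}"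
proof -
  obtain u u' where "x = {u, u'}" "u \<inter> u' = {}" "u \<union> u' = ground"
    using assms unfolding folded_verts_def by blast
  moreover from this have "u' = ground - u"
    by blast
  ultimately show thesis
    using that by blast
qed

text \<open>The family is the union of the vertices in \<open>C\<close>. These are disjoint and have
  two elements each, since exactly one of a set and its complement contains
  \<open>1\<close>.\<close>

lemma sum_ind: "(\<Sum>u\<in>Pow ground. ind u) = 2 * real (card C)"
proof -
  have mem: "Pow ground \<inter> {u. {u, ground - u} \<in> C} = \<Union> C"
  proof (intro equalityI subsetI)
    fix v assume "v \<in> \<Union> C"
    then obtain x where x: "x \<in> C" "v \<in> x"
      by blast
    obtain u where u: "u \<subseteq> ground" "x = {u, ground - u}"
      using folded_vertE x code_subset by blast
    then have "v = u \<or> v = ground - u"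
      using x by blast
    then have "v \<subseteq> ground" "{v, ground - v} = x"
      using u by (auto simp: double_diff)
    then show "v \<in> Pow ground \<inter> {u. {u, ground - u} \<in> C}"
      using x by simp
  qed auto
  have two: "card x = 2 \<and> (\<forall>v\<in>x. x = {v, ground - v})" if x: "x \<in> C" for x
  proof -
    obtain u where u: "u \<subseteq> ground" "x = {u, ground - u}"
      using folded_vertE x code_subset by blast
    moreover have "1 \<in> u \<longleftrightarrow> 1 \<notin> ground - u"
      by simp
    then have "u \<noteq> ground - u"
      by metis
    ultimately show ?thesis
      by (auto simp: double_diff)
  qed
  have "pairwise disjnt C"
    unfolding pairwise_def disjnt_iff using two by metis
  then have "card (\<Union> C) = sum card C"
    using two by (intro card_Union_disjoint) (metis card.infinite zero_neq_numeral)+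
  also have "\<dots> = 2 * card C"
    using two by simp
  finally have "card (\<Union> C) = 2 * card C" .
  moreover have "(\<Sum>u\<in>Pow ground. ind u) = real (card (Pow ground \<inter> {u. {u, ground - u} \<in> C}))"
    unfolding ind_def by (rule sum_of_bool_eq) simp_all
  ultimately show ?thesis
    unfolding mem by simp
qed

text \<open>The number of pairs of a member of the family and a permutation, that is, the value of
  the triple count at two empty sets.\<close>

definition norm_const :: real where
  "norm_const = (\<Sum>u\<in>Pow ground. ind u) * fact (2 * D + 1)"

lemma finite_code: "finite C"
proof (rule finite_subset[OF code_subset])
  show "finite (folded_verts D)"
    by (rule finite_subset[of _ "Pow (Pow ground)"]) (auto simp: folded_verts_def)
qed

lemma sum_permutations_const: "(\<Sum>p | p permutes ground. a) = a * fact (2 * D + 1)" for a :: real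
proof -
  have "card {p. p permutes ground} = fact (2 * D + 1)"
    by (rule card_permutations) simp_all
  then show ?thesis
    by (simp only: sum_constant of_nat_fact mult.commute)
qed

lemma norm_const_pos: "0 < norm_const"
  using finite_code code_nonempty unfolding norm_const_def sum_ind by (simp add: card_gt_0_iff)

section \<open>The symmetrised kernels and their invariances\<close>

text \<open>The weight \<open>w\<close> on the base point separates three uses: \<open>ind\<close>
  counts triples in the family, \<open>1\<close> counts pairs, and \<open>1 - ind\<close> takes base
  points outside the family.\<close>

definition form :: "(nat set \<Rightarrow> real) \<Rightarrow> nat set \<Rightarrow> nat set \<Rightarrow> real" where
  "form w A B = (\<Sum>p | p permutes ground. \<Sum>u\<in>Pow ground.
     w u * ind (sym_diff u (p ` A)) * ind (sym_diff u (p ` B)))"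

lemma form_commute: "form w A B = form w B A"
  unfolding form_def by (simp add: mult_ac)

lemma form_nonneg: "(\<And>u. 0 \<le> w u) \<Longrightarrow> 0 \<le> form w A B"
  unfolding form_def by (intro sum_nonneg mult_nonneg_nonneg ind_nonneg)

lemma form_image:
  assumes "q permutes ground"
  shows "form w (q ` A) (q ` B) = form w A B"
  unfolding form_def
  by (subst (2) sum_permutations_compose_right[OF assms]) (simp add: image_comp)

lemma form_of_type:
  assumes "A \<subseteq> ground" "B \<subseteq> ground" "A' \<subseteq> ground" "B' \<subseteq> ground"
    and "card A = card A'" "card B = card B'" "card (A \<inter> B) = card (A' \<inter> B')"
  shows "form w A B = form w A' B'"
proof -
  obtain p where "p permutes ground" "p ` A = A'" "p ` B = B'"
    using exists_permutation_of_type[OF _ assms] by blast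
  then show ?thesis
    using form_image[of p w A B] by simp
qed

text \<open>Each pair of a permutation and a base point contributes a rank-one kernel with
  nonnegative weight.\<close>

lemma form_psd:
  assumes "\<And>u. 0 \<le> w u"
  shows "0 \<le> (\<Sum>A\<in>F. \<Sum>B\<in>F. f A * form w A B * f B)"
proof -
  let ?P = "{p. p permutes ground} \<times> Pow ground"
  have "form w A B = (\<Sum>z\<in>?P. w (snd z) * ind (sym_diff (snd z) (fst z ` A)) *
      ind (sym_diff (snd z) (fst z ` B)))" for A B
    unfolding form_def by (subst sum.cartesian_product) (simp add: case_prod_beta)
  then show ?thesis
    using assms by (simp add: sum_gram_nonneg)
qed

lemma sum_sym_diff:
  assumes "E \<subseteq> ground"
  shows "(\<Sum>u\<in>Pow ground. g (sym_diff u E)) = (\<Sum>u\<in>Pow ground. g u)"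
proof (rule sum.reindex_bij_witness[where i = "\<lambda>u. sym_diff u E" and j = "\<lambda>u. sym_diff u E"])
  show "sym_diff (sym_diff u E) E = u" for u
    by blast
  then show "sym_diff (sym_diff u E) E = u" for u .
qed (use assms in auto)

lemma image_sym_diff: "inj p \<Longrightarrow> p ` sym_diff A B = sym_diff (p ` A) (p ` B)"
  by (simp add: image_Un image_set_diff)

lemma sym_diff_sym_diff: "sym_diff (sym_diff u A) B = sym_diff u (sym_diff A B)"
  by blast

lemma permutes_image_subset:
  "p permutes ground \<Longrightarrow> A \<subseteq> ground \<Longrightarrow> p ` A \<subseteq> ground"
  using permutes_image by blast

text \<open>Moving the base point from \<open>u\<close> to \<open>sym_diff u (p\<close> +
  \<open>A)\<close> keeps the triple of sets and replaces the sides \<open>A\<close>,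
  \<open>B\<close> by \<open>A\<close>, \<open>sym_diff A B\<close>. The weight \<open>ind\<close>
  treats the base point like the other two sets.\<close>

lemma form_sym_diff:
  assumes "A \<subseteq> ground"
  shows "form ind A (sym_diff A B) = form ind A B"
  unfolding form_def
proof (rule sum.cong[OF refl])
  fix p assume "p \<in> {p. p permutes ground}"
  then have p: "p ` A \<subseteq> ground" "inj p"
    using assms permutes_image_subset permutes_inj by auto
  have "(\<Sum>u\<in>Pow ground. ind u * ind (sym_diff u (p ` A)) * ind (sym_diff u (p ` B))) =
      (\<Sum>u\<in>Pow ground. ind (sym_diff u (p ` A)) * ind (sym_diff (sym_diff u (p ` A)) (p ` A)) *
        ind (sym_diff (sym_diff u (p ` A)) (p ` B)))"
    by (rule sum_sym_diff[OF p(1), symmetric])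
  also have "\<dots> = (\<Sum>u\<in>Pow ground. ind u * ind (sym_diff u (p ` A)) *
      ind (sym_diff u (p ` sym_diff A B)))"
    unfolding image_sym_diff[OF p(2)] sym_diff_sym_diff by (simp add: mult_ac)
  finally show "(\<Sum>u\<in>Pow ground. ind u * ind (sym_diff u (p ` A)) *
      ind (sym_diff u (p ` sym_diff A B))) =
      (\<Sum>u\<in>Pow ground. ind u * ind (sym_diff u (p ` A)) * ind (sym_diff u (p ` B)))"
    by simp
qed

text \<open>Complementing \<open>B\<close> complements the translated set, and \<open>ind\<close>
  does not distinguish a set from its complement.\<close>

lemma form_compl:
  assumes "B \<subseteq> ground"
  shows "form w A (ground - B) = form w A B"
  unfolding form_def
proof (intro sum.cong refl)
  fix p u assume "p \<in> {p. p permutes ground}" and u: "u \<in> Pow ground"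
  then have p: "p ` B \<subseteq> ground" "inj p" "p ` ground = ground"
    using assms permutes_image_subset permutes_inj permutes_image by (simp_all only: mem_Collect_eq)
  have "sym_diff u (p ` (ground - B)) = ground - sym_diff u (p ` B)"
    unfolding image_set_diff[OF p(2)] p(3) using p(1) u by blast
  moreover have "sym_diff u (p ` B) \<subseteq> ground"
    using p(1) u by blast
  ultimately show "w u * ind (sym_diff u (p ` A)) * ind (sym_diff u (p ` (ground - B))) =
      w u * ind (sym_diff u (p ` A)) * ind (sym_diff u (p ` B))"
    by (simp only: ind_compl)
qed

lemma form_empty: "form ind A {} = (\<Sum>p | p permutes ground. \<Sum>u\<in>Pow ground. ind u * ind (sym_diff u (p ` A)))"
  unfolding form_def
proof (intro sum.cong refl)
  fix p u
  show "ind u * ind (sym_diff u (p ` A)) * ind (sym_diff u (p ` {})) = ind u * ind (sym_diff u (p ` A))"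
    using ind_square[of u] by (simp add: mult_ac) (metis mult.assoc)
qed

text \<open>With constant weight the base point can be moved to the first translated set, so only
  the difference of the two sets matters. This produces the terms \<open>x\<close> at
  \<open>\<nu>\<close> in the second matrix.\<close>

lemma form_one:
  assumes "A \<subseteq> ground"
  shows "form (\<lambda>_. 1) A B = form ind (sym_diff A B) {}"
  unfolding form_empty unfolding form_def
proof (rule sum.cong[OF refl])
  fix p assume "p \<in> {p. p permutes ground}"
  then have p: "p ` A \<subseteq> ground" "inj p"
    using assms permutes_image_subset permutes_inj by auto
  have "(\<Sum>u\<in>Pow ground. 1 * ind (sym_diff u (p ` A)) * ind (sym_diff u (p ` B))) =
      (\<Sum>u\<in>Pow ground. 1 * ind (sym_diff (sym_diff u (p ` A)) (p ` A)) *
        ind (sym_diff (sym_diff u (p ` A)) (p ` B)))"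
    by (rule sum_sym_diff[OF p(1), symmetric])
  also have "\<dots> = (\<Sum>u\<in>Pow ground. ind u * ind (sym_diff u (p ` sym_diff A B)))"
    unfolding image_sym_diff[OF p(2)] sym_diff_sym_diff by simp
  finally show "(\<Sum>u\<in>Pow ground. 1 * ind (sym_diff u (p ` A)) * ind (sym_diff u (p ` B))) =
      (\<Sum>u\<in>Pow ground. ind u * ind (sym_diff u (p ` sym_diff A B)))" .
qed

lemma form_diff: "form (\<lambda>u. 1 - ind u) A B = form (\<lambda>_. 1) A B - form ind A B"
  by (simp add: form_def algebra_simps sum_subtractf)

text \<open>The bounds on the size of the symmetric difference exclude that \<open>u\<close> and
  \<open>v\<close> represent the same vertex; two distinct vertices of the code cannot be closer
  than \<open>d\<close>.\<close>

lemma ind_ind_eq_0: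
  assumes uv: "u \<subseteq> ground" "v \<subseteq> ground"
    and k: "1 \<le> card (sym_diff u v)" "card (sym_diff u v) \<le> 2 * D"
    and less: "card (sym_diff u v) < d \<or> 2 * D + 1 - card (sym_diff u v) < d"
  shows "ind u * ind v = 0"
proof (rule ccontr)
  assume "ind u * ind v \<noteq> 0"
  then have in_code: "{u, ground - u} \<in> C" "{v, ground - v} \<in> C"
    by (auto simp: ind_def)
  have compl: "sym_diff u (ground - v) = ground - sym_diff u v"
    using uv by blast
  have fin: "finite (sym_diff u v)"
    using uv finite_subset by blast
  have "card (ground - sym_diff u v) = 2 * D + 1 - card (sym_diff u v)"
    using uv fin by (subst card_Diff_subset) auto
  then have "folded_dist {u, ground - u} {v, ground - v} < d"
    using less uv compl by (subst folded_dist_eq[where D = D]) auto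
  moreover have "{u, ground - u} \<noteq> {v, ground - v}"
  proof
    assume "{u, ground - u} = {v, ground - v}"
    then have "u = v \<or> u = ground - v"
      by (auto simp: doubleton_eq_iff)
    then have "sym_diff u v = {} \<or> sym_diff u v = ground"
      using uv by auto
    then show False
      using k by auto
  qed
  ultimately show False
    using code_dist[OF in_code] by simp
qed


section \<open>The feasible point obtained from a code\<close>

text \<open>The two intervals are a standard pair of sets of sizes \<open>i\<close> and
  \<open>j\<close>: for \<open>t \<le> i\<close> and \<open>t \<le> j\<close> they overlap in the
  \<open>t\<close> points \<open>{i - t + 1..i}\<close>.\<close>

definition count_var :: "nat \<Rightarrow> nat \<Rightarrow> nat \<Rightarrow> real" where
  "count_var i j t = form ind {1..i} {i - t + 1..i + j - t} / norm_const"

lemma count_var_eq_form: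
  assumes sub: "A \<subseteq> ground" "B \<subseteq> ground"
  shows "count_var (card A) (card B) (card (A \<inter> B)) = form ind A B / norm_const"
proof -
  have fin: "finite A" "finite B"
    using sub finite_subset by blast+
  define i j t where "i = card A" and "j = card B" and "t = card (A \<inter> B)"
  have le: "t \<le> i" "t \<le> j"
    unfolding i_def j_def t_def using fin by (auto intro: card_mono)
  have "card (A \<union> B) \<le> card ground"
    using sub by (intro card_mono) auto
  then have n: "i + j - t \<le> 2 * D + 1"
    using card_Un_Int[OF fin] by (simp add: i_def j_def t_def)
  have "{1..i} \<inter> {i - t + 1..i + j - t} = {i - t + 1..i}"
    using le by auto
  then have "card ({1..i} \<inter> {i - t + 1..i + j - t}) = t"
    using le by simp
  then have "form ind {1..i} {i - t + 1..i + j - t} = form ind A B"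
    using sub le n by (intro form_of_type) (auto simp: i_def j_def t_def)
  then show ?thesis
    by (simp add: count_var_def i_def j_def t_def)
qed

lemma card_sym_diff:
  assumes "A \<subseteq> ground" "B \<subseteq> ground"
  shows "card (sym_diff A B) + 2 * card (A \<inter> B) = card A + card B"
proof -
  have fin: "finite A" "finite B"
    using assms finite_subset by blast+
  have "card (sym_diff A B) = card (A - B) + card (B - A)"
    using fin by (intro card_Un_disjoint) auto
  then show ?thesis
    using card_Int_Diff[OF fin(1), of B] card_Int_Diff[OF fin(2), of A] by (simp add: Int_commute)
qed

lemma count_var_eq_formI:
  assumes "A \<subseteq> ground" "B \<subseteq> ground" "card A = i" "card B = j" "t \<le> i" "t \<le> j"
    and "card (sym_diff A B) = i + j - 2 * t"
  shows "count_var i j t = form ind A B / norm_const"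
proof -
  have "card (A \<inter> B) = t"
    using card_sym_diff[OF assms(1,2)] assms(3-7) by linarith
  then show ?thesis
    using count_var_eq_form[OF assms(1,2)] assms(3,4) by simp
qed

lemma idxE:
  assumes "(i, j, t) \<in> idx D"
  obtains A B where "A \<subseteq> ground" "B \<subseteq> ground" "card A = i" "card B = j" "card (A \<inter> B) = t"
    "card (sym_diff A B) = i + j - 2 * t" "count_var i j t = form ind A B / norm_const"
proof -
  let ?A = "{1..i}" and ?B = "{i - t + 1..i + j - t}"
  have idx: "t \<le> i" "t \<le> j" "i \<le> D" "j \<le> D"
    using assms by (auto simp: idx_def)
  then have sub: "?A \<subseteq> ground" "?B \<subseteq> ground"
    by auto
  have "?A \<inter> ?B = {i - t + 1..i}"
    using idx by auto
  then have int: "card (?A \<inter> ?B) = t"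
    using idx by simp
  have card: "card ?A = i" "card ?B = j"
    using idx by auto
  have "card (sym_diff ?A ?B) = i + j - 2 * t"
    using card_sym_diff[OF sub] card int by linarith
  then show thesis
    using that[OF sub card int] by (simp only: count_var_def)
qed

lemma card_compl: "A \<subseteq> ground \<Longrightarrow> card (ground - A) = 2 * D + 1 - card A"
  by (subst card_Diff_subset) (auto intro: finite_subset)

text \<open>The ground set has odd size, so complementation exchanges the levels up to
  \<open>D\<close> with those above and preserves \<open>ind\<close>. The low levels thus carry half
  of the total \<open>2 * card C\<close>.\<close>

lemma sum_ind_low_levels:
  assumes "u \<subseteq> ground"
  shows "(\<Sum>A | A \<subseteq> ground \<and> card A \<le> D. ind (sym_diff u A)) = real (card C)"
proof -
  let ?L = "{A. A \<subseteq> ground \<and> card A \<le> D}" and ?H = "{A. A \<subseteq> ground \<and> D < card A}"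
  have "(\<Sum>A\<in>?H. ind (sym_diff u A)) = (\<Sum>A\<in>?L. ind (sym_diff u A))"
  proof (rule sum.reindex_bij_witness[where i = "\<lambda>A. ground - A" and j = "\<lambda>A. ground - A"])
    fix A assume "A \<in> ?H"
    then have A: "A \<subseteq> ground" "D < card A"
      by auto
    show "ground - (ground - A) = A"
      using A by blast
    show "ground - A \<in> ?L"
      using A card_compl[of A] by simp
    have "sym_diff u (ground - A) = ground - sym_diff u A" "sym_diff u A \<subseteq> ground"
      using A assms by blast+
    then show "ind (sym_diff u (ground - A)) = ind (sym_diff u A)"
      by (simp only: ind_compl)
  next
    fix A assume "A \<in> ?L"
    then have A: "A \<subseteq> ground" "card A \<le> D"
      by auto
    show "ground - (ground - A) = A"
      using A by blast
    show "ground - A \<in> ?H"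
      using A card_compl[of A] by simp
  qed
  moreover have "(\<Sum>A\<in>Pow ground. ind (sym_diff u A)) =
      (\<Sum>A\<in>?L. ind (sym_diff u A)) + (\<Sum>A\<in>?H. ind (sym_diff u A))"
  proof -
    have "Pow ground = ?L \<union> ?H"
      by auto
    then show ?thesis
      by (simp only:, intro sum.union_disjoint) (auto intro: finite_subset[of _ "Pow ground"])
  qed
  moreover have "(\<Sum>A\<in>Pow ground. ind (sym_diff u A)) = 2 * real (card C)"
  proof -
    have "sym_diff u A = sym_diff A u" for A
      by blast
    then show ?thesis
      using sum_sym_diff[OF assms, of ind] sum_ind by (simp only:)
  qed
  ultimately show ?thesis
    by simp
qed

text \<open>The binomial weights count the sets on each level, so the objective is a sum over all
  sets of size at most \<open>D\<close>. For fixed permutation and base point in the family this sum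
  is \<open>card C\<close>.\<close>

lemma objective_count_var: "sdp_objective D count_var = real (card C)"
proof -
  let ?F = "\<lambda>i. {A. A \<subseteq> ground \<and> card A = i}"
  let ?L = "{A. A \<subseteq> ground \<and> card A \<le> D}"
  have fin: "finite ?L"
    by (rule finite_subset[of _ "Pow ground"]) auto
  have level: "real (2 * D + 1 choose i) * count_var i 0 0 = (\<Sum>A\<in>?F i. form ind A {} / norm_const)" for i
  proof -
    have "(\<Sum>A\<in>?F i. form ind A {} / norm_const) = (\<Sum>A\<in>?F i. count_var i 0 0)"
    proof (intro sum.cong refl)
      fix A assume "A \<in> ?F i"
      then show "form ind A {} / norm_const = count_var i 0 0"
        using count_var_eq_form[of A "{}"] by simp
    qed
    also have "\<dots> = real (2 * D + 1 choose i) * count_var i 0 0"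
      using n_subsets[of ground i] by simp
    finally show ?thesis
      by simp
  qed
  have "sdp_objective D count_var = (\<Sum>i\<in>{0..D}. \<Sum>A | A \<in> ?L \<and> card A = i. form ind A {} / norm_const)"
    unfolding sdp_objective_def level by (intro sum.cong refl) auto
  also have "\<dots> = (\<Sum>A\<in>?L. form ind A {} / norm_const)"
    using fin by (intro sum.group) auto
  also have "\<dots> = (\<Sum>A\<in>?L. form ind A {}) / norm_const"
    by (rule sum_divide_distrib[symmetric])
  also have "(\<Sum>A\<in>?L. form ind A {}) = (\<Sum>p | p permutes ground. \<Sum>A\<in>?L. \<Sum>u\<in>Pow ground.
      ind u * ind (sym_diff u (p ` A)))"
    unfolding form_empty by (rule sum.swap)
  also have "\<dots> = (\<Sum>p | p permutes ground. \<Sum>u\<in>Pow ground. ind u * real (card C))"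
  proof (rule sum.cong[OF refl])
    fix p assume p: "p \<in> {p. p permutes ground}"
    have "bij_betw ((`) p) ?L ?L"
    proof (rule bij_betw_byWitness[where f' = "(`) (inv p)"])
      have 1: "inv p ` p ` A = A" "p ` inv p ` A = A" for A
        using p by (auto simp: image_image permutes_inverses)
      show "\<forall>A\<in>?L. inv p ` p ` A = A" "\<forall>A\<in>?L. p ` inv p ` A = A"
        using 1 by auto
      have "q ` A \<in> ?L" if q: "q permutes ground" and A: "A \<in> ?L" for q A
        using A permutes_image_subset[OF q] card_image[OF inj_on_subset[OF permutes_inj[OF q]], of A]
        by simp
      then show "(`) p ` ?L \<subseteq> ?L" "(`) (inv p) ` ?L \<subseteq> ?L"
        using p permutes_inv by blast+
    qed
    then have "(\<Sum>A\<in>?L. ind (sym_diff u (p ` A))) = (\<Sum>A\<in>?L. ind (sym_diff u A))" for u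
      by (rule sum.reindex_bij_betw)
    then have "(\<Sum>A\<in>?L. ind u * ind (sym_diff u (p ` A))) = ind u * real (card C)"
      if "u \<in> Pow ground" for u
      using that sum_ind_low_levels by (simp only: Pow_iff flip: sum_distrib_left)
    then show "(\<Sum>A\<in>?L. \<Sum>u\<in>Pow ground. ind u * ind (sym_diff u (p ` A))) =
        (\<Sum>u\<in>Pow ground. ind u * real (card C))"
      by (subst sum.swap) (intro sum.cong refl)
  qed
  also have "\<dots> = norm_const * real (card C)"
    unfolding norm_const_def sum_distrib_right[symmetric] sum_permutations_const by (simp only: mult_ac)
  finally show ?thesis
    using norm_const_pos by simp
qed

text \<open>\<open>E\<close> is the third side of the triangle, or its complement, and
  \<open>F\<close> converts its size accordingly. Any two of \<open>A\<close>, \<open>B\<close>,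
  \<open>E\<close> have the remaining one as symmetric difference up to complement, and the triple
  count is the same for all three pairs. Both families of symmetry constraints follow.\<close>

lemma count_var_triangle:
  assumes A: "A \<subseteq> ground" and B: "B \<subseteq> ground"
    and E: "E = sym_diff A B \<and> F = (\<lambda>k. k) \<or> E = ground - sym_diff A B \<and> F = (\<lambda>k. 2 * D + 1 - k)"
    and idx: "(i', j', t') \<in> idx D"
    and perm: "{#i', j', F (i' + j' - 2 * t')#} = {#card A, card B, card E#}"
  shows "count_var i' j' t' = form ind A B / norm_const"
proof -
  have t': "t' \<le> i'" "t' \<le> j'" "i' \<le> D" "j' \<le> D"
    using idx by (auto simp: idx_def)
  have Esub: "E \<subseteq> ground"
    using A B E by blast
  have AE: "card (sym_diff A E) = F (card B)" and BE: "card (sym_diff B E) = F (card A)"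
    and AB: "card (sym_diff A B) = F (card E)"
  proof -
    consider "E = sym_diff A B" "F = (\<lambda>k. k)"
      | "E = ground - sym_diff A B" "F = (\<lambda>k. 2 * D + 1 - k)"
      using E by blast
    then have "card (sym_diff A E) = F (card B) \<and> card (sym_diff B E) = F (card A)
      \<and> card (sym_diff A B) = F (card E)"
    proof cases
      case 1
      then have "sym_diff A E = B" "sym_diff B E = A"
        by blast+
      with 1 show ?thesis
        by simp
    next
      case 2
      then have "sym_diff A E = ground - B" "sym_diff B E = ground - A" "sym_diff A B = ground - E"
        using A B by blast+
      with 2 show ?thesis
        using card_compl[OF A] card_compl[OF B] card_compl[OF Esub] by simp
    qed
    then show "card (sym_diff A E) = F (card B)" "card (sym_diff B E) = F (card A)"
      "card (sym_diff A B) = F (card E)" by blast+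
  qed
  \<comment> \<open>The reflection is undone exactly because
    \<open>i' + j' - 2 * t' \<le> 2 * D\<close>, so no subtraction is truncated.\<close>
  have FF: "F (F (i' + j' - 2 * t')) = i' + j' - 2 * t'"
    using E t' by auto
  have swap: "sym_diff X Y = sym_diff Y X" for X Y :: "nat set"
    by blast
  have form_E: "form ind A E = form ind A B" "form ind B E = form ind A B"
  proof -
    have "sym_diff A B \<subseteq> ground"
      using A B by blast
    then show "form ind A E = form ind A B" "form ind B E = form ind A B"
      using E form_sym_diff[OF A, of B] form_sym_diff[OF B, of A] swap[of A B]
        form_compl[of "sym_diff A B" ind] form_commute[of ind B A] by (metis (no_types))+
  qed
  have main: "count_var i' j' t' = form ind X Y / norm_const"
    if "X \<subseteq> ground" "Y \<subseteq> ground" "card X = i'" "card Y = j'"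
      "card (sym_diff X Y) = F (F (i' + j' - 2 * t'))" for X Y
    using that t' FF by (intro count_var_eq_formI) auto
  from perm show ?thesis
  proof (cases rule: mset_triple_eqE)
    case 1
    then show ?thesis
      using main[OF A B] AB by simp
  next
    case 2
    then show ?thesis
      using main[OF A Esub] AE form_E by simp
  next
    case 3
    then show ?thesis
      using main[OF B A] AB swap[of A B] form_commute[of ind B A] by (simp only:)
  next
    case 4
    then show ?thesis
      using main[OF B Esub] BE form_E by simp
  next
    case 5
    then show ?thesis
      using main[OF Esub A] AE swap[of A E] form_commute[of ind E A] form_E by (simp only:)
  next
    case 6
    then show ?thesis
      using main[OF Esub B] BE swap[of B E] form_commute[of ind E B] form_E by (simp only:)
  qed
qed

lemma count_var_bounds:
  assumes "(i, j, t) \<in> idx D"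
  shows "0 \<le> count_var i j t" "count_var i j t \<le> count_var i 0 0"
proof -
  obtain A B where AB: "A \<subseteq> ground" "card A = i" "count_var i j t = form ind A B / norm_const"
    using idxE[OF assms] by metis
  have "form ind A B \<le> form ind A {}"
    unfolding form_empty unfolding form_def
    by (intro sum_mono mult_left_le mult_nonneg_nonneg ind_nonneg ind_le_1)
  moreover have "count_var i 0 0 = form ind A {} / norm_const"
    using count_var_eq_form[of A "{}"] AB by simp
  ultimately show "count_var i j t \<le> count_var i 0 0"
    using AB norm_const_pos by (simp add: divide_right_mono)
  show "0 \<le> count_var i j t"
    using AB norm_const_pos form_nonneg[OF ind_nonneg] by simp
qed

text \<open>Every summand vanishes: the three sets in it differ pairwise in \<open>i\<close>,
  \<open>j\<close> and \<open>i + j - 2 * t\<close> points, and a forbidden value puts two of them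
  too close together.\<close>

lemma count_var_eq_0:
  assumes idx: "(i, j, t) \<in> idx D"
    and "{i, j, i + j - 2 * t, 2 * D + 1 - (i + j - 2 * t)} \<inter> {1..d - 1} \<noteq> {}"
  shows "count_var i j t = 0"
proof -
  obtain A B where AB: "A \<subseteq> ground" "B \<subseteq> ground" "card A = i" "card B = j"
    "card (sym_diff A B) = i + j - 2 * t" "count_var i j t = form ind A B / norm_const"
    using idxE[OF idx] by metis
  have le: "i \<le> D" "j \<le> D"
    using idx by (auto simp: idx_def)
  let ?k = "i + j - 2 * t"
  have cases: "i \<in> {1..d - 1} \<or> j \<in> {1..d - 1} \<or> ?k \<in> {1..d - 1} \<or> 2 * D + 1 - ?k \<in> {1..d - 1}"
    using assms(2) by blast
  have "ind u * ind (sym_diff u (p ` A)) * ind (sym_diff u (p ` B)) = 0"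
    if "p permutes ground" "u \<in> Pow ground" for p u
  proof -
    have u: "u \<subseteq> ground"
      using that by simp
    have pAB: "p ` A \<subseteq> ground" "p ` B \<subseteq> ground" "inj p"
      using permutes_image_subset[OF that(1)] permutes_inj[OF that(1)] AB by auto
    have sub: "sym_diff u (p ` A) \<subseteq> ground" "sym_diff u (p ` B) \<subseteq> ground"
      using u pAB by blast+
    have card_p: "card (p ` X) = card X" for X
      using pAB(3) by (intro card_image) (auto intro: inj_on_subset)
    have "sym_diff u (sym_diff u (p ` A)) = p ` A" "sym_diff u (sym_diff u (p ` B)) = p ` B"
      by blast+
    then have d1: "card (sym_diff u (sym_diff u (p ` A))) = i"
      and d2: "card (sym_diff u (sym_diff u (p ` B))) = j"
      using card_p AB(3,4) by (simp_all only:)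
    have "sym_diff (sym_diff u (p ` A)) (sym_diff u (p ` B)) = p ` sym_diff A B"
      unfolding image_sym_diff[OF pAB(3)] by blast
    then have d3: "card (sym_diff (sym_diff u (p ` A)) (sym_diff u (p ` B))) = ?k"
      using card_p AB(5) by (simp only:)
    \<comment> \<open>If \<open>?k\<close> were \<open>0\<close>, the last alternative would put
      \<open>2 * D + 1\<close> into \<open>{1..d - 1}\<close>, contrary to
      \<open>d_le\<close>.\<close>
    have "i \<in> {1..d - 1} \<or> j \<in> {1..d - 1} \<or> 1 \<le> ?k \<and> (?k < d \<or> 2 * D + 1 - ?k < d)"
      using cases d_le unfolding atLeastAtMost_iff by arith
    then consider "i \<in> {1..d - 1}" | "j \<in> {1..d - 1}"
      | "1 \<le> ?k" "?k < d \<or> 2 * D + 1 - ?k < d"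
      by blast
    then show ?thesis
    proof cases
      case 1
      then have "ind u * ind (sym_diff u (p ` A)) = 0"
        using le by (intro ind_ind_eq_0[OF u sub(1)]; unfold d1) auto
      then show ?thesis by simp
    next
      case 2
      then have "ind u * ind (sym_diff u (p ` B)) = 0"
        using le by (intro ind_ind_eq_0[OF u sub(2)]; unfold d2) auto
      then show ?thesis by auto
    next
      case 3
      then have "ind (sym_diff u (p ` A)) * ind (sym_diff u (p ` B)) = 0"
        using le by (intro ind_ind_eq_0[OF sub]; unfold d3) auto
      then show ?thesis by auto
    qed
  qed
  then have "form ind A B = 0"
    unfolding form_def by (intro sum.neutral ballI) simp
  then show ?thesis
    using AB by simp
qed

lemma count_var_0: "count_var 0 0 0 = 1"
proof -
  have "form ind {} {} = norm_const"
    unfolding form_empty norm_const_def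
    by (simp only: image_empty Diff_empty empty_Diff Un_empty_right ind_square sum_permutations_const)
  then show ?thesis
    using count_var_eq_form[of "{}" "{}"] norm_const_pos by simp
qed

lemma psd_count_var:
  "psd_on {r..D} (\<lambda>i j. \<Sum>t | (i, j, t) \<in> idx D. beta_coeff D r i j t * count_var i j t)"
proof (rule psd_on_beta_coeff[where M = "\<lambda>A B. form ind A B / norm_const"])
  fix f :: "nat set \<Rightarrow> real"
  have "(\<Sum>A\<in>Pow ground. \<Sum>B\<in>Pow ground. f A * (form ind A B / norm_const) * f B) =
      (\<Sum>A\<in>Pow ground. \<Sum>B\<in>Pow ground. f A * form ind A B * f B) / norm_const"
    by (simp add: sum_divide_distrib)
  then show "0 \<le> (\<Sum>A\<in>Pow ground. \<Sum>B\<in>Pow ground. f A * (form ind A B / norm_const) * f B)"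
    using form_psd[OF ind_nonneg] norm_const_pos by simp
qed (simp_all only: form_commute count_var_eq_form)

text \<open>The entries come from the kernel with weight \<open>1 - ind\<close>, the difference of
  the pair count and the triple count; that weight is nonnegative.\<close>

lemma psd_count_var_compl:
  "psd_on {r..D} (\<lambda>i j. \<Sum>t | (i, j, t) \<in> idx D. beta_coeff D r i j t *
    (count_var (min (i + j - 2 * t) (2 * D + 1 - (i + j - 2 * t))) 0 0 - count_var i j t))"
proof (rule psd_on_beta_coeff[where M = "\<lambda>A B. form (\<lambda>u. 1 - ind u) A B / norm_const"
      and m = "\<lambda>i j t. count_var (min (i + j - 2 * t) (2 * D + 1 - (i + j - 2 * t))) 0 0 - count_var i j t"])
  let ?w = "\<lambda>u. 1 - ind u"
  fix f :: "nat set \<Rightarrow> real"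
  have "(\<Sum>A\<in>Pow ground. \<Sum>B\<in>Pow ground. f A * (form ?w A B / norm_const) * f B) =
      (\<Sum>A\<in>Pow ground. \<Sum>B\<in>Pow ground. f A * form ?w A B * f B) / norm_const"
    by (simp add: sum_divide_distrib)
  then show "0 \<le> (\<Sum>A\<in>Pow ground. \<Sum>B\<in>Pow ground. f A * (form ?w A B / norm_const) * f B)"
    using form_psd[of ?w] ind_le_1 norm_const_pos by simp
next
  fix A B assume AB: "A \<subseteq> ground" "B \<subseteq> ground" "card A \<le> D" "card B \<le> D"
  let ?k = "card A + card B - 2 * card (A \<inter> B)"
  \<comment> \<open>The difference set or its complement, whichever has at most \<open>D\<close>
    elements; \<open>form_compl\<close> makes the choice harmless.\<close>
  let ?E = "if ?k \<le> D then sym_diff A B else ground - sym_diff A B"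
  have sub: "sym_diff A B \<subseteq> ground" "?E \<subseteq> ground"
    using AB by auto
  have k: "card (sym_diff A B) = ?k"
    using card_sym_diff[OF AB(1,2)] by simp
  have E: "card ?E = min ?k (2 * D + 1 - ?k)"
    using k card_compl[OF sub(1)] by (simp only: if_distrib[of card] k) auto
  have "form ind ?E {} = form ind (sym_diff A B) {}"
    using form_compl[OF sub(1), of ind "{}"] form_commute[of ind "{}"] by (simp split: if_split)
  also have "\<dots> = form (\<lambda>_. 1) A B"
    by (rule form_one[OF AB(1), symmetric])
  finally have "count_var (min ?k (2 * D + 1 - ?k)) 0 0 = form (\<lambda>_. 1) A B / norm_const"
    using count_var_eq_form[OF sub(2), of "{}"] E by simp
  then show "count_var (min ?k (2 * D + 1 - ?k)) 0 0 - count_var (card A) (card B) (card (A \<inter> B)) =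
      form (\<lambda>u. 1 - ind u) A B / norm_const"
    using count_var_eq_form[OF AB(1,2)] by (simp add: form_diff diff_divide_distrib)
qed (simp only: form_commute)

lemma feasible_count_var: "sdp_feasible D d count_var"
proof -
  have perm3: "count_var i j t = count_var i' j' t'"
    if idx: "(i, j, t) \<in> idx D" and idx': "(i', j', t') \<in> idx D"
      and eq: "{#i', j', i' + j' - 2 * t'#} = {#i, j, i + j - 2 * t#}" for i j t i' j' t'
  proof -
    obtain A B where AB: "A \<subseteq> ground" "B \<subseteq> ground" "card A = i" "card B = j"
      "card (sym_diff A B) = i + j - 2 * t" "count_var i j t = form ind A B / norm_const"
      using idxE[OF idx] by metis
    show ?thesis
      using count_var_triangle[OF AB(1,2) _ idx', of "sym_diff A B" "\<lambda>k. k"] AB(3-6) eq by simp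
  qed
  have perm4: "count_var i j t = count_var i' j' t'"
    if idx: "(i, j, t) \<in> idx D" and idx': "(i', j', t') \<in> idx D"
      and eq: "{#i', j', 2 * D + 1 - (i' + j' - 2 * t')#} = {#i, j, 2 * D + 1 - (i + j - 2 * t)#}"
    for i j t i' j' t'
  proof -
    obtain A B where AB: "A \<subseteq> ground" "B \<subseteq> ground" "card A = i" "card B = j"
      "card (sym_diff A B) = i + j - 2 * t" "count_var i j t = form ind A B / norm_const"
      using idxE[OF idx] by metis
    have "sym_diff A B \<subseteq> ground"
      using AB by blast
    then have "card (ground - sym_diff A B) = 2 * D + 1 - (i + j - 2 * t)"
      using card_compl[of "sym_diff A B"] AB(5) by (simp only:)
    then show ?thesis
      using count_var_triangle[OF AB(1,2) _ idx', of "ground - sym_diff A B" "\<lambda>k. 2 * D + 1 - k"]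
        AB(3-6) eq by simp
  qed
  show ?thesis
    unfolding sdp_feasible_def
    by (intro conjI; (rule count_var_0 | (clarify; (rule conjI)?;
        ((rule count_var_bounds; assumption) | (rule perm3; assumption) | (rule perm4; assumption) |
         (rule count_var_eq_0; assumption) | rule psd_count_var psd_count_var_compl))))
qed

end

section \<open>From a maximum code to the optimal value\<close>

theorem theorem5p7:
  fixes D d :: nat
  assumes "3 \<le> D" and "1 \<le> d" and "d \<le> 2 * D + 1"
  shows "ereal (real (A_folded D d)) \<le> sdp_value D d"
proof -
  define K where "K = {card C |C. C \<subseteq> folded_verts D \<and>
    (\<forall>x\<in>C. \<forall>y\<in>C. x \<noteq> y \<longrightarrow> d \<le> folded_dist x y)}"
  have fin: "finite (folded_verts D)"
    by (rule finite_subset[of _ "Pow (Pow {1..2 * D + 1})"]) (auto simp: folded_verts_def)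
  have "K \<subseteq> card ` Pow (folded_verts D)"
    by (auto simp: K_def)
  then have finK: "finite K"
    using fin finite_subset by blast
  \<comment> \<open>A single vertex is a code for every \<open>d\<close>, so the maximum is at least
    \<open>1\<close> and is attained by a nonempty code, as \<open>folded_code\<close>
    requires.\<close>
  have "{{}, {1..2 * D + 1}} \<in> folded_verts D"
    unfolding folded_verts_def by blast
  then have "card {{{}, {1..2 * D + 1}}} \<in> K"
    unfolding K_def by blast
  then have one: "1 \<in> K"
    by simp
  have A: "A_folded D d = Max K"
    by (simp add: A_folded_def max_code_size_def K_def)
  have "1 \<le> A_folded D d"
    unfolding A using Max_ge[OF finK one] .
  moreover have "A_folded D d \<in> K"
    unfolding A using Max_in[OF finK] one by blast
  ultimately obtain C where C: "C \<subseteq> folded_verts D" "A_folded D d = card C" "1 \<le> card C"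
    "\<forall>x\<in>C. \<forall>y\<in>C. x \<noteq> y \<longrightarrow> d \<le> folded_dist x y"
    unfolding K_def by fastforce
  then interpret folded_code D d C
    using assms by unfold_locales auto
  have "ereal (sdp_objective D count_var) \<le> sdp_value D d"
    unfolding sdp_value_def using feasible_count_var by (intro SUP_upper) simp
  then show ?thesis
    using objective_count_var C by simp
qed

end
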